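(* Let $R$ be a locally nilpotent ring and let $\delta: R \to R$ be a derivation of $R$. Then the differential polynomial ring $R[X;\delta]$ cannot be mapped onto a ring with a non-zero idempotent; that is, if $A$ is a ring and $\varphi: R[X;\delta] \to A$ is a surjective ring homomorphism, then the only element $e \in A$ with $e^2 = e$ is $e = 0$.
   Context: Rings are associative and not necessarily unital (a non-zero locally nilpotent ring has no unity), and ring homomorphisms are additive and multiplicative maps. A ring $R$ is locally nilpotent if every finitely generated subring $S$ of $R$ is nilpotent, i.e. $S^n = 0$ for some positive integer $n$. A derivation of $R$ is an additive map $\delta: R \to R$ with $\delta(ab) = \delta(a)b + a\delta(b)$ for all $a,b \in R$. The differential polynomial ring $R[X;\delta]$ is the ring of polynomials in the indeterminate $X$ with all coefficients in $R$ (including the constant term; $X$ itself need not belong to $R[X;\delta]$), with the usual addition and with multiplication determined by the condition $Xr = rX + \delta(r)$ for all $r \in R$. *)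

theory Defs
  imports "HOL-Computational_Algebra.Polynomial"
begin

text \<open>
  Rings are types of class \<open>ring\<close>, which does not require a unit or commutativity and
  admits the zero ring.
\<close>

definition is_subring :: "'a::ring set \<Rightarrow> bool" where
  "is_subring S \<longleftrightarrow> 0 \<in> S \<and> (\<forall>a\<in>S. \<forall>b\<in>S. a - b \<in> S \<and> a * b \<in> S)"

definition is_add_subgroup :: "'a::ring set \<Rightarrow> bool" where
  "is_add_subgroup S \<longleftrightarrow> 0 \<in> S \<and> (\<forall>a\<in>S. \<forall>b\<in>S. a - b \<in> S)"

definition finitely_generated_subring :: "'a::ring set \<Rightarrow> bool" where
  "finitely_generated_subring S \<longleftrightarrow> (\<exists>X. finite X \<and> S = is_subring hull X)"

text \<open>
  The power \<open>S\<^sup>n\<close>, for \<open>n > 0\<close>, is the additive subgroup generated by all products of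
  \<open>n\<close> elements of \<open>S\<close>. There is no unit to serve as an empty product, so a product of
  \<open>n\<close> factors is given by its last factor and the list of the \<open>n - 1\<close> preceding ones.
\<close>

definition ring_power :: "'a::ring set \<Rightarrow> nat \<Rightarrow> 'a set" where
  "ring_power S n =
    is_add_subgroup hull {foldr (*) as b | as b. set as \<subseteq> S \<and> b \<in> S \<and> Suc (length as) = n}"

definition nilpotent_ring :: "'a::ring set \<Rightarrow> bool" where
  "nilpotent_ring S \<longleftrightarrow> (\<exists>n>0. ring_power S n = {0})"

definition locally_nilpotent :: "'a::ring itself \<Rightarrow> bool" where
  "locally_nilpotent _ \<longleftrightarrow>
    (\<forall>S :: 'a set. finitely_generated_subring S \<longrightarrow> nilpotent_ring S)"

definition derivation :: "('a::ring \<Rightarrow> 'a) \<Rightarrow> bool" where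
  "derivation \<delta> \<longleftrightarrow>
    (\<forall>a b. \<delta> (a + b) = \<delta> a + \<delta> b) \<and> (\<forall>a b. \<delta> (a * b) = \<delta> a * b + a * \<delta> b)"

text \<open>
  The differential polynomial ring \<open>R[X;\<delta>]\<close> is the additive group \<open>'a poly\<close> (coefficients
  written on the left of the powers of \<open>X\<close>) with the product \<open>dpoly_mult \<delta>\<close>. Left
  multiplication by \<open>X\<close>, which need not be an element of the ring, is the operator
  \<open>\<Sum>\<^sub>j r\<^sub>j X\<^sup>j \<mapsto> \<Sum>\<^sub>j (r\<^sub>j X + \<delta> r\<^sub>j) X\<^sup>j\<close> forced by \<open>X r = r X + \<delta> r\<close>, and
  \<open>(\<Sum>\<^sub>i a\<^sub>i X\<^sup>i) q = \<Sum>\<^sub>i a\<^sub>i (X\<^sup>i q)\<close>.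
\<close>

definition X_mult :: "('a::ring \<Rightarrow> 'a) \<Rightarrow> 'a poly \<Rightarrow> 'a poly" where
  "X_mult \<delta> q = pCons 0 q + map_poly \<delta> q"

definition left_mult :: "'a::ring \<Rightarrow> 'a poly \<Rightarrow> 'a poly" where
  "left_mult a q = map_poly (\<lambda>b. a * b) q"

definition dpoly_mult :: "('a::ring \<Rightarrow> 'a) \<Rightarrow> 'a poly \<Rightarrow> 'a poly \<Rightarrow> 'a poly" where
  "dpoly_mult \<delta> p q = (\<Sum>i\<le>degree p. left_mult (coeff p i) ((X_mult \<delta> ^^ i) q))"

definition dpoly_ring_hom :: "('a::ring \<Rightarrow> 'a) \<Rightarrow> ('a poly \<Rightarrow> 'b::ring) \<Rightarrow> bool" where
  "dpoly_ring_hom \<delta> \<phi> \<longleftrightarrow>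
    (\<forall>p q. \<phi> (p + q) = \<phi> p + \<phi> q) \<and> (\<forall>p q. \<phi> (dpoly_mult \<delta> p q) = \<phi> p * \<phi> q)"


text \<open>With this product, \<open>'a poly\<close> is an associative ring.\<close>

lemma derivation_zero: "derivation \<delta> \<Longrightarrow> \<delta> 0 = 0"
  unfolding derivation_def by (metis add_cancel_right_right add.right_neutral)

lemma coeff_left_mult: "coeff (left_mult a q) n = a * coeff q n"
  by (simp add: left_mult_def coeff_map_poly)

lemma coeff_X_mult:
  "derivation \<delta> \<Longrightarrow> coeff (X_mult \<delta> q) n = (if n = 0 then 0 else coeff q (n - 1)) + \<delta> (coeff q n)"
  by (simp add: X_mult_def coeff_map_poly derivation_zero coeff_pCons split: nat.split)

lemma left_mult_add: "left_mult a (p + q) = left_mult a p + left_mult a q"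
  by (rule poly_eqI) (simp add: coeff_left_mult distrib_left)

lemma left_mult_add_left: "left_mult (a + b) q = left_mult a q + left_mult b q"
  by (rule poly_eqI) (simp add: coeff_left_mult distrib_right)

lemma left_mult_zero [simp]: "left_mult 0 q = 0" "left_mult a 0 = 0"
  by (rule poly_eqI, simp add: coeff_left_mult)+

lemma left_mult_left_mult: "left_mult a (left_mult b q) = left_mult (a * b) q"
  by (rule poly_eqI) (simp add: coeff_left_mult mult.assoc)

lemma left_mult_sum: "left_mult a (sum f A) = (\<Sum>i\<in>A. left_mult a (f i))"
  by (induction A rule: infinite_finite_induct) (auto simp: left_mult_add)

lemma X_mult_add: "derivation \<delta> \<Longrightarrow> X_mult \<delta> (p + q) = X_mult \<delta> p + X_mult \<delta> q"
  by (rule poly_eqI) (simp add: coeff_X_mult derivation_def algebra_simps)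

lemma X_mult_zero: "derivation \<delta> \<Longrightarrow> X_mult \<delta> 0 = 0"
  by (rule poly_eqI) (simp add: coeff_X_mult derivation_zero)

lemma X_mult_sum: "derivation \<delta> \<Longrightarrow> X_mult \<delta> (sum f A) = (\<Sum>i\<in>A. X_mult \<delta> (f i))"
  by (induction A rule: infinite_finite_induct) (auto simp: X_mult_add X_mult_zero)

lemma X_mult_left_mult:
  "derivation \<delta> \<Longrightarrow> X_mult \<delta> (left_mult a q) = left_mult a (X_mult \<delta> q) + left_mult (\<delta> a) q"
  by (rule poly_eqI)
     (simp add: coeff_X_mult coeff_left_mult derivation_def algebra_simps)

lemma X_mult_pow_add:
  "derivation \<delta> \<Longrightarrow> (X_mult \<delta> ^^ i) (p + q) = (X_mult \<delta> ^^ i) p + (X_mult \<delta> ^^ i) q"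
  by (induction i) (auto simp: X_mult_add)

lemma dpoly_mult_bound:
  assumes "degree p \<le> N"
  shows "dpoly_mult \<delta> p q = (\<Sum>i\<le>N. left_mult (coeff p i) ((X_mult \<delta> ^^ i) q))"
  unfolding dpoly_mult_def
  by (rule sum.mono_neutral_left) (use assms in \<open>auto simp: coeff_eq_0\<close>)

lemma dpoly_mult_add_left: "dpoly_mult \<delta> (p + p') q = dpoly_mult \<delta> p q + dpoly_mult \<delta> p' q"
proof -
  let ?N = "max (degree p) (degree p')"
  have "degree (p + p') \<le> ?N" by (rule degree_add_le_max)
  then show ?thesis
    by (simp add: dpoly_mult_bound[where N = ?N] left_mult_add_left sum.distrib)
qed

lemma dpoly_mult_zero_left [simp]: "dpoly_mult \<delta> 0 q = 0"
  by (simp add: dpoly_mult_def)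

lemma dpoly_mult_sum_left: "dpoly_mult \<delta> (sum f A) q = (\<Sum>i\<in>A. dpoly_mult \<delta> (f i) q)"
  by (induction A rule: infinite_finite_induct) (auto simp: dpoly_mult_add_left)

lemma dpoly_mult_add_right:
  "derivation \<delta> \<Longrightarrow> dpoly_mult \<delta> p (q + q') = dpoly_mult \<delta> p q + dpoly_mult \<delta> p q'"
  by (simp add: dpoly_mult_def X_mult_pow_add left_mult_add sum.distrib)

lemma dpoly_mult_left_mult: "dpoly_mult \<delta> (left_mult a q) r = left_mult a (dpoly_mult \<delta> q r)"
proof -
  have "degree (left_mult a q) \<le> degree q"
    by (rule degree_le) (simp add: coeff_left_mult coeff_eq_0)
  then show ?thesis
    by (simp add: dpoly_mult_bound[where N = "degree q"] left_mult_sum left_mult_left_mult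
        coeff_left_mult)
qed

lemma dpoly_mult_X_mult:
  assumes "derivation \<delta>"
  shows "dpoly_mult \<delta> (X_mult \<delta> q) r = X_mult \<delta> (dpoly_mult \<delta> q r)"
proof -
  let ?T = "\<lambda>i. (X_mult \<delta> ^^ i) r"
  let ?N = "degree q"
  have 1: "dpoly_mult \<delta> (pCons 0 q) r = (\<Sum>i\<le>?N. left_mult (coeff q i) (X_mult \<delta> (?T i)))"
  proof -
    have "degree (pCons 0 q) \<le> Suc ?N" by (rule degree_pCons_le)
    then show ?thesis
      by (simp add: dpoly_mult_bound[where N = "Suc ?N"] sum.atMost_Suc_shift del: sum.atMost_Suc)
  qed
  have 2: "dpoly_mult \<delta> (map_poly \<delta> q) r = (\<Sum>i\<le>?N. left_mult (\<delta> (coeff q i)) (?T i))"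
  proof -
    have "degree (map_poly \<delta> q) \<le> ?N" by (rule degree_le) (simp add: coeff_map_poly derivation_zero assms coeff_eq_0)
    then show ?thesis
      by (simp add: dpoly_mult_bound[where N = ?N] coeff_map_poly derivation_zero assms)
  qed
  have "dpoly_mult \<delta> (X_mult \<delta> q) r =
      dpoly_mult \<delta> (pCons 0 q) r + dpoly_mult \<delta> (map_poly \<delta> q) r"
    by (simp add: X_mult_def dpoly_mult_add_left)
  also have "\<dots> = X_mult \<delta> (dpoly_mult \<delta> q r)"
    unfolding 1 2 dpoly_mult_def[of \<delta> q r] X_mult_sum[OF assms] X_mult_left_mult[OF assms]
    by (simp add: sum.distrib)
  finally show ?thesis .
qed

lemma dpoly_mult_X_mult_pow:
  "derivation \<delta> \<Longrightarrow> dpoly_mult \<delta> ((X_mult \<delta> ^^ i) q) r = (X_mult \<delta> ^^ i) (dpoly_mult \<delta> q r)"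
  by (induction i) (auto simp: dpoly_mult_X_mult)

lemma dpoly_mult_assoc:
  assumes "derivation \<delta>"
  shows "dpoly_mult \<delta> (dpoly_mult \<delta> p q) r = dpoly_mult \<delta> p (dpoly_mult \<delta> q r)"
  by (simp add: dpoly_mult_def[of \<delta> p] dpoly_mult_sum_left dpoly_mult_left_mult
      dpoly_mult_X_mult_pow assms)

lemma dpoly_ring:
  assumes "derivation \<delta>"
  shows "class.ring (+) 0 (-) uminus (dpoly_mult \<delta>)"
  by unfold_locales
     (auto simp: dpoly_mult_assoc dpoly_mult_add_left dpoly_mult_add_right assms)

lemma dpoly_mult_monom_const:
  assumes "derivation \<delta>"
  shows "dpoly_mult \<delta> (monom s 1) (monom r 0) = monom (s * r) 1 + monom (s * \<delta> r) 0"
proof -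
  have "dpoly_mult \<delta> (monom s 1) (monom r 0) = left_mult s (X_mult \<delta> (monom r 0))"
    using dpoly_mult_bound[OF degree_monom_le, of \<delta> s 1] by simp
  also have "\<dots> = monom (s * r) 1 + monom (s * \<delta> r) 0"
    by (rule poly_eqI) (auto simp: coeff_left_mult coeff_X_mult assms derivation_zero)
  finally show ?thesis .
qed

end

theory Submission
  imports Defs
begin

text \<open>
  Lift the idempotent to \<open>e \<in> R[X;\<delta>]\<close> and work modulo an ideal \<open>I\<close>, closed under multiplication by
  \<open>X\<close> on both sides, that is maximal subject to \<open>e \<notin> I\<close>. By maximality, for every \<open>\<delta>\<close>-stable ideal
  \<open>Q\<close> of \<open>R\<close> not contained in \<open>I\<close>, \<open>e\<close> is congruent to a polynomial with coefficients in \<open>Q\<close>.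

  Were \<open>e\<^sup>2 - e\<close> to have all coefficients in \<open>I\<close>, comparing coefficients in degrees up to \<open>degree e\<close>
  would express the coefficients of \<open>e\<close> through themselves by a nilpotent matrix. So there is a
  relation \<open>b X\<^sup>n \<equiv> terms of degree < n\<close> with \<open>b \<notin> I\<close>. The elements of \<open>R\<close> that admit such a reduction
  for all exponents up to \<open>n + s\<close> form a \<open>\<delta>\<close>-stable ideal \<open>Q s\<close> that is again not contained in \<open>I\<close>.

  Let \<open>E\<close> be the ring of those \<open>v\<close> for which \<open>X\<^sup>a v\<close> reduces to degree \<open>< n\<close> for all \<open>a < n\<close>. It is
  locally nilpotent modulo \<open>I\<close>, being represented by \<open>n \<times> n\<close> matrices over \<open>R\<close>, and it is stable under
  the commutator with \<open>X\<close>. Writing \<open>e \<equiv> \<Sum>\<^sub>j k\<^sub>j X\<^sup>j\<close> with \<open>k\<^sub>j \<in> Q (degree e)\<close>, the elements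
  \<open>p\<^sub>j = e k\<^sub>j\<close> lie in \<open>E\<close> and satisfy \<open>e p\<^sub>j \<equiv> p\<^sub>j\<close> and \<open>e \<equiv> \<Sum>\<^sub>j p\<^sub>j X\<^sup>j\<close>. The \<open>p\<^sub>j\<close> and their
  iterated commutators with \<open>X\<close> generate a nilpotent ring modulo \<open>I\<close>. If \<open>z\<close> is a longest product of
  them with \<open>e z \<equiv> z\<close> and \<open>z \<notin> I\<close>, then all \<open>p\<^sub>j X\<^sup>l z\<close> vanish, so \<open>z \<equiv> e z \<equiv> 0\<close>, a contradiction. Hence all
  \<open>p\<^sub>j\<close>, and with them \<open>e\<close>, lie in \<open>I\<close>.
\<close>

section \<open>Powers of finitely generated subrings\<close>

lemma is_add_subgroup_hull: "is_add_subgroup (is_add_subgroup hull X)"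
  by (rule hull_in) (auto simp: is_add_subgroup_def)

lemma add_subgroup_zero: "is_add_subgroup S \<Longrightarrow> 0 \<in> S"
  by (simp add: is_add_subgroup_def)

lemma add_subgroup_diff: "is_add_subgroup S \<Longrightarrow> a \<in> S \<Longrightarrow> b \<in> S \<Longrightarrow> a - b \<in> S"
  by (simp add: is_add_subgroup_def)

lemma add_subgroup_add: "is_add_subgroup S \<Longrightarrow> a \<in> S \<Longrightarrow> b \<in> S \<Longrightarrow> a + b \<in> S"
  using add_subgroup_diff[of S a "0 - b"] add_subgroup_diff[of S 0 b] add_subgroup_zero[of S] by simp

lemma add_subgroup_sum:
  "is_add_subgroup S \<Longrightarrow> (\<And>i. i \<in> A \<Longrightarrow> f i \<in> S) \<Longrightarrow> sum f A \<in> S"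
  by (induction A rule: infinite_finite_induct) (auto simp: add_subgroup_add add_subgroup_zero)

lemma add_subgroup_hull_mult_left:
  assumes "y \<in> is_add_subgroup hull X" "\<And>x. x \<in> X \<Longrightarrow> m * x \<in> Y"
  shows "m * y \<in> is_add_subgroup hull Y"
  using assms(1)
proof (rule hull_induct)
  show "is_add_subgroup {y. m * y \<in> is_add_subgroup hull Y}"
    using is_add_subgroup_hull[of Y]
    by (subst is_add_subgroup_def)
       (simp add: right_diff_distrib add_subgroup_zero add_subgroup_diff)
qed (simp add: assms(2) hull_inc)

lemma add_subgroup_hull_mult_right:
  assumes "y \<in> is_add_subgroup hull X" "\<And>x. x \<in> X \<Longrightarrow> x * m \<in> Y"
  shows "y * m \<in> is_add_subgroup hull Y"
  using assms(1)
proof (rule hull_induct)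
  show "is_add_subgroup {y. y * m \<in> is_add_subgroup hull Y}"
    using is_add_subgroup_hull[of Y]
    by (subst is_add_subgroup_def)
       (simp add: left_diff_distrib add_subgroup_zero add_subgroup_diff)
qed (simp add: assms(2) hull_inc)

lemma ring_power_mult_left:
  assumes "m \<in> S" "y \<in> ring_power S n"
  shows "m * y \<in> ring_power S (Suc n)"
  using assms(2) unfolding ring_power_def
proof (rule add_subgroup_hull_mult_left)
  fix x assume "x \<in> {foldr (*) as b |as b. set as \<subseteq> S \<and> b \<in> S \<and> Suc (length as) = n}"
  then obtain as b where *: "x = foldr (*) as b" "set as \<subseteq> S" "b \<in> S" "Suc (length as) = n"
    by blast
  show "m * x \<in> {foldr (*) as b |as b. set as \<subseteq> S \<and> b \<in> S \<and> Suc (length as) = Suc n}"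
    using * assms(1) by (intro CollectI exI[of _ "m # as"] exI[of _ b]) simp
qed

lemma ring_power_mult_right:
  assumes "m \<in> S" "y \<in> ring_power S n"
  shows "y * m \<in> ring_power S (Suc n)"
  using assms(2) unfolding ring_power_def
proof (rule add_subgroup_hull_mult_right)
  fix x assume "x \<in> {foldr (*) as b |as b. set as \<subseteq> S \<and> b \<in> S \<and> Suc (length as) = n}"
  then obtain as b where *: "x = foldr (*) as b" "set as \<subseteq> S" "b \<in> S" "Suc (length as) = n"
    by blast
  have "foldr (*) as b * m = foldr (*) (as @ [b]) m"
    by (induction as) (simp_all add: mult.assoc)
  with * show "x * m \<in> {foldr (*) as b |as b. set as \<subseteq> S \<and> b \<in> S \<and> Suc (length as) = Suc n}"
    using assms(1) by (intro CollectI exI[of _ "as @ [b]"] exI[of _ m]) simp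
qed

text \<open>\<open>P r\<close> is the power with exponent \<open>r + 1\<close> of the subring
  generated by \<open>G\<close>; the shift is due to the missing zeroth power.\<close>

lemma locally_nilpotent_powers:
  fixes G :: "'a::ring set"
  assumes "locally_nilpotent TYPE('a)" "finite G"
  obtains P k where "\<And>r. is_add_subgroup (P r)" "G \<subseteq> P 0"
    "\<And>r m y. m \<in> G \<Longrightarrow> y \<in> P r \<Longrightarrow> m * y \<in> P (Suc r)"
    "\<And>r m y. m \<in> G \<Longrightarrow> y \<in> P r \<Longrightarrow> y * m \<in> P (Suc r)"
    "P k = {0}"
proof -
  let ?S = "is_subring hull G"
  have "finitely_generated_subring ?S"
    using assms(2) unfolding finitely_generated_subring_def by blast
  with assms(1) have "nilpotent_ring ?S"
    unfolding locally_nilpotent_def by blast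
  then obtain n where n: "n > 0" "ring_power ?S n = {0}"
    unfolding nilpotent_ring_def by blast
  have GS: "G \<subseteq> ?S" by (rule hull_subset)
  show ?thesis
  proof (rule that)
    show "is_add_subgroup (ring_power ?S (Suc r))" for r
      unfolding ring_power_def by (rule is_add_subgroup_hull)
    show "G \<subseteq> ring_power ?S (Suc 0)"
    proof
      fix g assume "g \<in> G"
      with GS have "g \<in> ?S" by blast
      then show "g \<in> ring_power ?S (Suc 0)"
        unfolding ring_power_def
        by (intro hull_inc CollectI exI[of _ "[]"] exI[of _ g]) simp
    qed
    show "ring_power ?S (Suc (n - 1)) = {0}" using n by simp
    fix r m y assume "m \<in> G" "y \<in> ring_power ?S (Suc r)"
    then show "m * y \<in> ring_power ?S (Suc (Suc r))" "y * m \<in> ring_power ?S (Suc (Suc r))"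
      using GS by (auto intro: ring_power_mult_left ring_power_mult_right)
  qed
qed


section \<open>Differential polynomials\<close>

lemma pCons_0_add: "pCons 0 (p + q) = pCons 0 p + pCons (0 :: 'a::ring) q"
  by (rule poly_eqI) (simp add: coeff_pCons split: nat.split)

lemma pCons_0_diff: "pCons 0 (p - q) = pCons 0 p - pCons (0 :: 'a::ring) q"
  by (rule poly_eqI) (simp add: coeff_pCons split: nat.split)

lemma pCons_0_sum: "pCons 0 (sum f A) = (\<Sum>i\<in>A. pCons (0 :: 'a::ring) (f i))"
  by (induction A rule: infinite_finite_induct) (auto simp: pCons_0_add)

lemma left_mult_pCons_0: "left_mult a (pCons 0 q) = pCons 0 (left_mult a q)"
  by (rule poly_eqI) (simp add: coeff_left_mult coeff_pCons split: nat.split)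

lemma left_mult_monom: "left_mult a (monom b i) = monom (a * b) i"
  by (rule poly_eqI) (simp add: coeff_left_mult)

lemma coeff_dpoly_mult:
  "coeff (dpoly_mult \<delta> p q) n = (\<Sum>i\<le>degree p. coeff p i * coeff ((X_mult \<delta> ^^ i) q) n)"
  by (simp add: dpoly_mult_def coeff_sum coeff_left_mult)

lemma dpoly_mult_const_left: "dpoly_mult \<delta> (monom a 0) q = left_mult a q"
  using dpoly_mult_bound[OF degree_monom_le, of \<delta> a 0 q] by simp

definition deriv_ideal :: "('a::ring \<Rightarrow> 'a) \<Rightarrow> 'a set \<Rightarrow> bool" where
  "deriv_ideal \<delta> Q \<longleftrightarrow> is_add_subgroup Q \<and>
    (\<forall>a\<in>Q. \<delta> a \<in> Q \<and> (\<forall>b. a * b \<in> Q \<and> b * a \<in> Q))"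

text \<open>\<open>X\<close> need not belong to the ring, so stability under multiplication by it is
  demanded separately: \<open>X_mult\<close> acts on the left, \<open>pCons 0\<close> on the
  right.\<close>

definition X_ideal :: "('a::ring \<Rightarrow> 'a) \<Rightarrow> 'a poly set \<Rightarrow> bool" where
  "X_ideal \<delta> I \<longleftrightarrow> 0 \<in> I \<and> (\<forall>p\<in>I. \<forall>q\<in>I. p - q \<in> I) \<and>
    (\<forall>p\<in>I. X_mult \<delta> p \<in> I \<and> pCons 0 p \<in> I \<and>
      (\<forall>q. dpoly_mult \<delta> p q \<in> I \<and> dpoly_mult \<delta> q p \<in> I))"

definition coeffs_in :: "'a::ring set \<Rightarrow> 'a poly set" where
  "coeffs_in Q = {p. \<forall>i. coeff p i \<in> Q}"

locale ring_derivation =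
  fixes \<delta> :: "'a::ring \<Rightarrow> 'a"
  assumes derivation: "derivation \<delta>"
begin

abbreviation mul :: "'a poly \<Rightarrow> 'a poly \<Rightarrow> 'a poly" (infixl "\<odot>" 70) where
  "p \<odot> q \<equiv> dpoly_mult \<delta> p q"

abbreviation L :: "'a poly \<Rightarrow> 'a poly" where "L \<equiv> X_mult \<delta>"

abbreviation R :: "'a poly \<Rightarrow> 'a poly" where "R \<equiv> pCons 0"

lemmas delta_0 [simp] = derivation_zero[OF derivation]
lemmas L_add = X_mult_add[OF derivation]
lemmas L_0 [simp] = X_mult_zero[OF derivation]
lemmas L_mul = dpoly_mult_X_mult[OF derivation]
lemmas coeff_L = coeff_X_mult[OF derivation]
lemmas mul_assoc = dpoly_mult_assoc[OF derivation]
lemmas mul_add_right = dpoly_mult_add_right[OF derivation]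

sublocale dring: ring "(+)" 0 "(-)" uminus "dpoly_mult \<delta>"
  by (rule dpoly_ring[OF derivation])

lemma delta_add: "\<delta> (a + b) = \<delta> a + \<delta> b"
  using derivation by (auto simp: derivation_def)

lemma delta_diff: "\<delta> (a - b) = \<delta> a - \<delta> b"
  using delta_add[of "a - b" b] by simp

lemma L_diff: "L (p - q) = L p - L q"
  using L_add[of "p - q" q] by simp

lemma L_pow_diff: "(L ^^ i) (p - q) = (L ^^ i) p - (L ^^ i) q"
  by (induction i) (auto simp: L_diff)

lemma L_R: "L (R p) = R (L p)"
  by (rule poly_eqI) (auto simp: coeff_L coeff_pCons split: nat.split)

lemma L_pow_R: "(L ^^ i) (R p) = R ((L ^^ i) p)"
  by (induction i) (auto simp: L_R)

lemma mul_R: "p \<odot> R q = R (p \<odot> q)"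
  by (simp add: dpoly_mult_def L_pow_R left_mult_pCons_0 pCons_0_sum)

lemma R_mul: "R p \<odot> q = p \<odot> L q"
proof -
  have "degree (R p) \<le> Suc (degree p)" by (rule degree_pCons_le)
  then show ?thesis
    by (simp add: dpoly_mult_bound[where N = "Suc (degree p)"] sum.atMost_Suc_shift
        dpoly_mult_def funpow_Suc_right del: sum.atMost_Suc funpow.simps(2))
qed

lemma L_minus_R: "L p - R p = map_poly \<delta> p"
  by (simp add: X_mult_def)

lemma L_coeffs_in: "deriv_ideal \<delta> Q \<Longrightarrow> p \<in> coeffs_in Q \<Longrightarrow> L p \<in> coeffs_in Q"
  by (auto simp: coeffs_in_def coeff_L deriv_ideal_def intro: add_subgroup_add)

lemma L_pow_coeffs_in: "deriv_ideal \<delta> Q \<Longrightarrow> p \<in> coeffs_in Q \<Longrightarrow> (L ^^ i) p \<in> coeffs_in Q"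
  by (induction i) (auto simp: L_coeffs_in)

lemma R_coeffs_in: "is_add_subgroup Q \<Longrightarrow> p \<in> coeffs_in Q \<Longrightarrow> R p \<in> coeffs_in Q"
  by (auto simp: coeffs_in_def coeff_pCons is_add_subgroup_def split: nat.split)

text \<open>A coefficient of the product is a sum of terms \<open>a * b\<close> with
  \<open>a\<close> a coefficient of \<open>p\<close> and \<open>b\<close> one of
  \<open>(L ^^ i) q\<close>; iterating \<open>L\<close> stays over the stable ideal
  \<open>Q\<close>.\<close>

lemma mul_coeffs_in:
  assumes "deriv_ideal \<delta> Q" "is_add_subgroup P" "\<And>a b. a \<in> A \<Longrightarrow> b \<in> Q \<Longrightarrow> a * b \<in> P"
    and "p \<in> coeffs_in A" "q \<in> coeffs_in Q"
  shows "p \<odot> q \<in> coeffs_in P"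
proof -
  have "coeff ((L ^^ i) q) n \<in> Q" for i n
    using L_pow_coeffs_in[OF assms(1,5)] by (simp add: coeffs_in_def)
  then show ?thesis
    using assms(2-4) by (auto simp: coeffs_in_def coeff_dpoly_mult intro!: add_subgroup_sum)
qed

lemma mul_coeffs_in_left:
  assumes "deriv_ideal \<delta> Q" "p \<in> coeffs_in Q"
  shows "p \<odot> q \<in> coeffs_in Q"
  using assms by (auto simp: coeffs_in_def coeff_dpoly_mult deriv_ideal_def intro!: add_subgroup_sum)

lemma mul_coeffs_in_right:
  assumes "deriv_ideal \<delta> Q" "q \<in> coeffs_in Q"
  shows "p \<odot> q \<in> coeffs_in Q"
  using assms by (intro mul_coeffs_in[of Q Q UNIV]) (auto simp: coeffs_in_def deriv_ideal_def)

lemma coeff_L_pow_above: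
  assumes "\<And>j. j \<ge> m \<Longrightarrow> coeff p j = 0" "j \<ge> m + i"
  shows "coeff ((L ^^ i) p) j = 0"
  using assms(2)
proof (induction i arbitrary: j)
  case (Suc i)
  then have "coeff ((L ^^ i) p) (j - 1) = 0" "coeff ((L ^^ i) p) j = 0" by auto
  with Suc.prems show ?case by (auto simp: coeff_L)
qed (use assms(1) in auto)

lemma monom_mul: "monom b i \<odot> q = left_mult b ((L ^^ i) q)"
proof -
  have "monom b i \<odot> q = (\<Sum>j\<le>i. left_mult (coeff (monom b i) j) ((L ^^ j) q))"
    by (rule dpoly_mult_bound) (rule degree_monom_le)
  also have "\<dots> = (\<Sum>j\<le>i. if j = i then left_mult b ((L ^^ i) q) else 0)"
    by (rule sum.cong) auto
  finally show ?thesis by simp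
qed

text \<open>That the lower terms keep the left factor \<open>b\<close> lets an induction on the
  exponent absorb them in \<open>deriv_ideal_Q\<close>.\<close>

lemma monom_mul_const:
  obtains u where "monom b i \<odot> monom c 0 = monom (b * c) i + left_mult b u"
    "\<And>j. j \<ge> i \<Longrightarrow> coeff u j = 0"
proof -
  have lead: "coeff ((L ^^ i) (monom c 0)) i = c"
  proof (induction i)
    case (Suc i)
    have "coeff ((L ^^ i) (monom c 0)) (Suc i) = 0"
      by (rule coeff_L_pow_above[of 1]) auto
    with Suc show ?case by (simp add: coeff_L)
  qed simp
  have above: "coeff ((L ^^ i) (monom c 0)) j = 0" if "j > i" for j
    by (rule coeff_L_pow_above[of 1]) (use that in auto)
  show ?thesis
  proof (rule that[of "(L ^^ i) (monom c 0) - monom c i"])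
    show "monom b i \<odot> monom c 0 =
        monom (b * c) i + left_mult b ((L ^^ i) (monom c 0) - monom c i)"
      by (rule poly_eqI) (simp add: monom_mul coeff_left_mult right_diff_distrib)
    show "coeff ((L ^^ i) (monom c 0) - monom c i) j = 0" if "j \<ge> i" for j
      using that lead above by (cases "j = i") auto
  qed
qed

lemma mul_sum_right: "p \<odot> sum f A = (\<Sum>i\<in>A. p \<odot> f i)"
  by (induction A rule: infinite_finite_induct) (simp_all add: mul_add_right)

lemma R_pow_monom: "(R ^^ i) (monom b j) = monom b (i + j)"
  by (induction i) (simp_all add: monom_Suc)

lemma coeff_R_pow: "coeff ((R ^^ i) p) j = (if j < i then 0 else coeff p (j - i))"
proof (induction i arbitrary: j)
  case (Suc i)
  then show ?case by (cases j) simp_all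
qed simp

lemma mul_R_pow: "p \<odot> (R ^^ i) q = (R ^^ i) (p \<odot> q)"
  by (induction i) (simp_all add: mul_R)

lemma R_pow_mul: "(R ^^ i) p \<odot> q = p \<odot> (L ^^ i) q"
proof (induction i arbitrary: q)
  case (Suc i)
  have "(R ^^ Suc i) p \<odot> q = (R ^^ i) p \<odot> L q" by (simp add: R_mul)
  then show ?case by (simp add: Suc funpow_swap1[of L i q])
qed simp

lemma monom_delta: "monom (\<delta> b) i = L (monom b i) - R (monom b i)"
  by (rule poly_eqI) (simp add: L_minus_R coeff_map_poly)

abbreviation D :: "'a poly \<Rightarrow> 'a poly" where "D p \<equiv> L p - R p"

lemma L_pow_D: "(L ^^ i) (D p) = D ((L ^^ i) p)"
  by (simp add: L_pow_diff L_pow_R funpow_swap1[of L i p])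

end

section \<open>An idempotent modulo a maximal ideal\<close>

locale idempotent_mod_ideal = ring_derivation +
  fixes I :: "'a poly set" and e :: "'a poly"
  assumes locally_nilpotent: "locally_nilpotent TYPE('a)"
    and X_ideal: "X_ideal \<delta> I"
    and idempotent: "e \<odot> e - e \<in> I"
    and e_notin: "e \<notin> I"
    and e_in_larger: "\<And>I'. X_ideal \<delta> I' \<Longrightarrow> I \<subset> I' \<Longrightarrow> e \<in> I'"
begin

lemma I_0: "0 \<in> I" and I_diff: "p \<in> I \<Longrightarrow> q \<in> I \<Longrightarrow> p - q \<in> I"
  and I_L: "p \<in> I \<Longrightarrow> L p \<in> I" and I_R: "p \<in> I \<Longrightarrow> R p \<in> I"
  and I_mul_left: "p \<in> I \<Longrightarrow> p \<odot> q \<in> I" and I_mul_right: "p \<in> I \<Longrightarrow> q \<odot> p \<in> I"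
  using X_ideal by (auto simp: X_ideal_def)

lemma I_uminus: "p \<in> I \<Longrightarrow> - p \<in> I"
  using I_diff[of 0 p] I_0 by simp

lemma I_add: "p \<in> I \<Longrightarrow> q \<in> I \<Longrightarrow> p + q \<in> I"
  using I_diff[of p "- q"] I_uminus by simp

lemma I_sum: "(\<And>i. i \<in> A \<Longrightarrow> f i \<in> I) \<Longrightarrow> sum f A \<in> I"
  by (induction A rule: infinite_finite_induct) (auto simp: I_0 I_add)

lemma I_left_mult: "p \<in> I \<Longrightarrow> left_mult a p \<in> I"
  using I_mul_right[of p "monom a 0"] by (simp add: dpoly_mult_const_left)

lemma I_R_pow: "p \<in> I \<Longrightarrow> (R ^^ i) p \<in> I"
  by (induction i) (auto simp: I_R)

lemma I_cong: "p - q \<in> I \<Longrightarrow> p \<in> I \<longleftrightarrow> q \<in> I"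
  using I_add[of "p - q" q] I_diff[of p "p - q"] by auto

lemma I_trans: "p - q \<in> I \<Longrightarrow> q - r \<in> I \<Longrightarrow> p - r \<in> I"
  using I_add[of "p - q" "q - r"] by simp

lemma I_sym: "p - q \<in> I \<Longrightarrow> q - p \<in> I"
  using I_uminus[of "p - q"] by simp

lemma I_mul_cong: "p - p' \<in> I \<Longrightarrow> q - q' \<in> I \<Longrightarrow> p \<odot> q - p' \<odot> q' \<in> I"
  using I_add[OF I_mul_left[of "p - p'" q] I_mul_right[of "q - q'" p']]
  by (simp add: dring.left_diff_distrib dring.right_diff_distrib)

text \<open>The contraction of \<open>I\<close> to the coefficient ring. Polynomials over
  \<open>N\<close> lie in \<open>I\<close>; the converse may fail, and this is where relations come
  from.\<close>

definition N :: "'a set" where "N = {b. monom b 0 \<in> I}"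

lemma deriv_ideal_N: "deriv_ideal \<delta> N"
proof -
  have "monom (a * b) 0 \<in> I" if "monom a 0 \<in> I" for a b
    using I_mul_left[OF that, of "monom b 0"] by (simp add: dpoly_mult_const_left left_mult_monom)
  then show ?thesis
    unfolding deriv_ideal_def is_add_subgroup_def N_def
    by (auto simp: I_0 monom_delta diff_monom[symmetric] left_mult_monom[symmetric]
        intro!: I_diff I_L I_R I_left_mult)
qed

lemma monom_in_I: "b \<in> N \<Longrightarrow> monom b i \<in> I"
  using I_R_pow[of "monom b 0" i] by (simp add: N_def R_pow_monom)

lemma coeffs_in_N: "p \<in> coeffs_in N \<Longrightarrow> p \<in> I"
  using I_sum[of "{..degree p}" "\<lambda>i. monom (coeff p i) i"]
  by (simp add: coeffs_in_def monom_in_I poly_as_sum_of_monoms)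

text \<open>\<open>I\<close> plus the polynomials over \<open>Q\<close> is again an
  \<open>X_ideal\<close>, strictly larger than \<open>I\<close> because of a constant in
  \<open>Q\<close> outside \<open>N\<close>; maximality puts \<open>e\<close> into it.\<close>

lemma e_cong_coeffs_in:
  assumes Q: "deriv_ideal \<delta> Q" "\<not> Q \<subseteq> N"
  obtains g where "g \<in> coeffs_in Q" "e - g \<in> I"
proof -
  let ?I' = "{p. \<exists>g\<in>coeffs_in Q. p - g \<in> I}"
  have sub: "is_add_subgroup Q" using Q(1) by (simp add: deriv_ideal_def)
  have "X_ideal \<delta> ?I'"
    unfolding X_ideal_def
  proof (intro conjI ballI allI)
    show "0 \<in> ?I'"
      using I_0 sub by (intro CollectI bexI[of _ 0]) (auto simp: coeffs_in_def is_add_subgroup_def)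
  next
    fix p q assume "p \<in> ?I'" "q \<in> ?I'"
    then obtain g h where gh: "g \<in> coeffs_in Q" "h \<in> coeffs_in Q" "p - g \<in> I" "q - h \<in> I" by blast
    have "p - q - (g - h) = (p - g) - (q - h)" by simp
    then have "p - q - (g - h) \<in> I" using I_diff[OF gh(3,4)] by (simp only:)
    moreover have "g - h \<in> coeffs_in Q"
      using gh sub by (auto simp: coeffs_in_def is_add_subgroup_def)
    ultimately show "p - q \<in> ?I'" by blast
  next
    fix p assume "p \<in> ?I'"
    then obtain g where g: "g \<in> coeffs_in Q" "p - g \<in> I" by blast
    have I': "r \<in> ?I'" if "h \<in> coeffs_in Q" "r - h \<in> I" for r h
      using that by blast
    show "L p \<in> ?I'"
      by (rule I'[OF L_coeffs_in[OF Q(1) g(1)]]) (simp only: L_diff[symmetric] I_L g)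
    show "R p \<in> ?I'"
      by (rule I'[OF R_coeffs_in[OF sub g(1)]]) (simp only: pCons_0_diff[symmetric] I_R g)
    fix q
    show "p \<odot> q \<in> ?I'"
      by (rule I'[OF mul_coeffs_in_left[OF Q(1) g(1), of q]])
         (simp only: dring.left_diff_distrib[symmetric] I_mul_left g)
    show "q \<odot> p \<in> ?I'"
      by (rule I'[OF mul_coeffs_in_right[OF Q(1) g(1), of q]])
         (simp only: dring.right_diff_distrib[symmetric] I_mul_right g)
  qed
  moreover have "I \<subset> ?I'"
  proof
    show "I \<subseteq> ?I'"
    proof
      fix p assume "p \<in> I"
      then show "p \<in> ?I'"
        using sub by (intro CollectI bexI[of _ 0]) (auto simp: coeffs_in_def is_add_subgroup_def)
    qed
    obtain b where b: "b \<in> Q" "b \<notin> N" using Q(2) by blast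
    then have "monom b 0 \<in> coeffs_in Q" "monom b 0 \<notin> I"
      using sub by (auto simp: coeffs_in_def is_add_subgroup_def N_def)
    moreover from this I_0 have "monom b 0 \<in> ?I'"
      by (intro CollectI bexI[of _ "monom b 0"]) simp_all
    ultimately show "I \<noteq> ?I'" by blast
  qed
  ultimately show ?thesis using e_in_larger[of ?I'] that by blast
qed

text \<open>Otherwise the coefficients of \<open>e\<close> form a row vector fixed modulo
  \<open>N\<close> by the matrix with entries \<open>coeff ((L ^^ j) e) q\<close>. Resubstitution
  moves them into every \<open>P r\<close> modulo \<open>N\<close>, hence into \<open>N\<close>, and
  \<open>e\<close> into \<open>I\<close>.\<close>

lemma ex_coeff_notin_N: "\<exists>q. coeff (e \<odot> e - e) q \<notin> N"
proof (rule ccontr)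
  assume "\<not> ?thesis"
  then have in_N: "coeff (e \<odot> e) q - coeff e q \<in> N" for q by simp
  have N: "is_add_subgroup N" using deriv_ideal_N by (simp add: deriv_ideal_def)
  let ?d = "degree e"
  let ?G = "(\<lambda>(j, q). coeff ((L ^^ j) e) q) ` ({..?d} \<times> {..?d})"
  obtain P k where P: "\<And>r. is_add_subgroup (P r)" "?G \<subseteq> P 0"
    "\<And>r m y. m \<in> ?G \<Longrightarrow> y \<in> P r \<Longrightarrow> y * m \<in> P (Suc r)" "P k = {0}"
    by (rule locally_nilpotent_powers[OF locally_nilpotent, of ?G]) auto
  have "\<exists>u\<in>P r. coeff e q - u \<in> N" for q r
  proof (induction r arbitrary: q)
    case 0
    have "coeff e q \<in> P 0"
    proof (cases "q \<le> ?d")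
      case True
      \<comment> \<open>The coefficients of \<open>e\<close> are row 0 of the matrix.\<close>
      then have "coeff ((L ^^ 0) e) q \<in> ?G" by (intro image_eqI[of _ _ "(0, q)"]) auto
      with P(2) show ?thesis by auto
    qed (simp add: coeff_eq_0 add_subgroup_zero[OF P(1)])
    with add_subgroup_zero[OF N] show ?case by (intro bexI[of _ "coeff e q"]) auto
  next
    case (Suc r)
    show ?case
    proof (cases "q \<le> ?d")
      case True
      from Suc obtain u where u: "\<And>j. u j \<in> P r" "\<And>j. coeff e j - u j \<in> N" by metis
      let ?m = "\<lambda>j. coeff ((L ^^ j) e) q"
      have "u j * ?m j \<in> P (Suc r)" if "j \<le> ?d" for j
        using that True by (intro P(3) u(1) image_eqI[of _ _ "(j, q)"]) auto
      then have "(\<Sum>j\<le>?d. u j * ?m j) \<in> P (Suc r)"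
        by (intro add_subgroup_sum P(1)) auto
      moreover have "coeff e q - (\<Sum>j\<le>?d. u j * ?m j) \<in> N"
      proof -
        have "(\<Sum>j\<le>?d. (coeff e j - u j) * ?m j) \<in> N"
          using u(2) deriv_ideal_N by (intro add_subgroup_sum N) (auto simp: deriv_ideal_def)
        then have "(\<Sum>j\<le>?d. (coeff e j - u j) * ?m j) - (coeff (e \<odot> e) q - coeff e q) \<in> N"
          using in_N add_subgroup_diff[OF N] by blast
        then show ?thesis
          by (simp add: coeff_dpoly_mult left_diff_distrib sum_subtractf)
      qed
      ultimately show ?thesis by blast
    qed (use add_subgroup_zero[OF P(1)] add_subgroup_zero[OF N] in
      \<open>auto simp: coeff_eq_0 intro!: bexI[of _ 0]\<close>)
  qed
  from this[of k] have "e \<in> coeffs_in N" by (simp add: P(4) coeffs_in_def)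
  with e_notin show False using coeffs_in_N by blast
qed

definition W :: "nat \<Rightarrow> 'a poly set" where
  "W n = {p. \<exists>v. (\<forall>i\<ge>n. coeff v i = 0) \<and> p - v \<in> I}"

text \<open>The top degree in which a coefficient of \<open>e \<odot> e - e\<close> escapes
  \<open>N\<close> provides the relation: all terms above it lie in \<open>I\<close>.\<close>

lemma ex_relation:
  obtains b n where "b \<notin> N" "monom b n \<in> W n"
proof -
  let ?r = "e \<odot> e - e"
  let ?A = "{q. coeff ?r q \<notin> N}"
  have "0 \<in> N" using I_0 by (simp add: N_def)
  have "?A \<subseteq> {..degree ?r}"
  proof
    fix q assume "q \<in> ?A"
    with \<open>0 \<in> N\<close> have "coeff ?r q \<noteq> 0" by auto
    then show "q \<in> {..degree ?r}" by (simp add: le_degree del: coeff_diff)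
  qed
  then have fin: "finite ?A" by (rule finite_subset) simp
  define n where "n = Max ?A"
  have n: "coeff ?r n \<notin> N"
    using Max_in[OF fin] ex_coeff_notin_N unfolding n_def by blast
  have above: "coeff ?r q \<in> N" if "q > n" for q
    using Max_ge[OF fin, of q] that unfolding n_def by (auto simp: not_le[symmetric])
  define h where "h = (\<Sum>q\<in>{n<..degree ?r}. monom (coeff ?r q) q)"
  have h: "h \<in> I" unfolding h_def by (intro I_sum monom_in_I above) simp
  have coeff_h: "coeff h i = (if i > n then coeff ?r i else 0)" for i
    by (cases "i \<le> degree ?r")
       (auto simp: h_def coeff_sum sum.delta coeff_eq_0 not_le simp del: coeff_diff)
  show ?thesis
  proof (rule that[OF n])
    show "monom (coeff ?r n) n \<in> W n"
      unfolding W_def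
    proof (intro CollectI exI conjI allI impI)
      show "coeff (monom (coeff ?r n) n - ?r + h) i = 0" if "n \<le> i" for i
        using that coeff_h by auto
      show "monom (coeff ?r n) n - (monom (coeff ?r n) n - ?r + h) \<in> I"
        using I_diff[OF idempotent h] by simp
    qed
  qed
qed

end

section \<open>The consequences of a relation\<close>

text \<open>
  \<open>W n\<close> is closed neither under \<open>L\<close> nor under \<open>R\<close>, but it is closed under the commutator
  \<open>D = L - R\<close>, which only differentiates coefficients. This is what makes \<open>Q s\<close> and \<open>E\<close>
  below stable under the derivation.
\<close>

locale idempotent_mod_ideal_relation = idempotent_mod_ideal +
  fixes b0 :: 'a and n :: nat
  assumes b0: "b0 \<notin> N" and relation: "monom b0 n \<in> W n"
begin

section \<open>Closure properties of \<open>W n\<close>\<close>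

lemma W_I: "p \<in> I \<Longrightarrow> p \<in> W n"
  by (auto simp: W_def intro!: exI[of _ 0])

lemma W_low: "(\<And>i. i \<ge> n \<Longrightarrow> coeff p i = 0) \<Longrightarrow> p \<in> W n"
  using I_0 by (auto simp: W_def intro!: exI[of _ p])

lemma W_map:
  assumes "p \<in> W n" "\<And>p. p \<in> I \<Longrightarrow> f p \<in> I" "\<And>p q. f (p - q) = f p - f q"
    and "\<And>v i. (\<And>i. i \<ge> n \<Longrightarrow> coeff v i = 0) \<Longrightarrow> i \<ge> n \<Longrightarrow> coeff (f v) i = 0"
  shows "f p \<in> W n"
proof -
  obtain v where v: "\<And>i. i \<ge> n \<Longrightarrow> coeff v i = 0" "p - v \<in> I"
    using assms(1) unfolding W_def by blast
  have "coeff (f v) i = 0" if "i \<ge> n" for i by (rule assms(4)) (use v(1) that in auto)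
  moreover have "f p - f v \<in> I" using assms(2)[OF v(2)] by (simp only: assms(3))
  ultimately show ?thesis unfolding W_def by blast
qed

lemma W_diff:
  assumes "p \<in> W n" "q \<in> W n"
  shows "p - q \<in> W n"
proof -
  obtain v w where v: "\<And>i. i \<ge> n \<Longrightarrow> coeff v i = 0" "p - v \<in> I"
    and w: "\<And>i. i \<ge> n \<Longrightarrow> coeff w i = 0" "q - w \<in> I"
    using assms unfolding W_def by blast
  have "p - q - (v - w) = (p - v) - (q - w)" by simp
  then have "p - q - (v - w) \<in> I" using I_diff[OF v(2) w(2)] by (simp only:)
  moreover have "coeff (v - w) i = 0" if "i \<ge> n" for i using that v(1) w(1) by simp
  ultimately show ?thesis unfolding W_def by blast
qed

lemma W_add: "p \<in> W n \<Longrightarrow> q \<in> W n \<Longrightarrow> p + q \<in> W n"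
  using W_diff[of p "0 - q"] W_diff[of 0 q] W_I[OF I_0] by simp

lemma W_sum: "(\<And>i. i \<in> A \<Longrightarrow> f i \<in> W n) \<Longrightarrow> sum f A \<in> W n"
  by (induction A rule: infinite_finite_induct) (auto simp: W_add W_I I_0)

lemma W_left_mult: "p \<in> W n \<Longrightarrow> left_mult a p \<in> W n"
proof (rule W_map[of p "left_mult a"])
  show "left_mult a (p - q) = left_mult a p - left_mult a q" for p q
    by (rule poly_eqI) (simp add: coeff_left_mult right_diff_distrib)
qed (simp_all add: I_left_mult coeff_left_mult)

lemma W_mul_const: "p \<in> W n \<Longrightarrow> p \<odot> monom c 0 \<in> W n"
proof (rule W_map[of p "\<lambda>p. p \<odot> monom c 0"])
  fix v :: "'a poly" and i assume v: "\<And>i. i \<ge> n \<Longrightarrow> coeff v i = 0" and i: "i \<ge> n"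
  have "coeff v j * coeff ((L ^^ j) (monom c 0)) i = 0" for j
  proof (cases "j \<ge> n")
    case False
    then have "coeff ((L ^^ j) (monom c 0)) i = 0"
      using i by (intro coeff_L_pow_above[of 1]) auto
    then show ?thesis by simp
  qed (simp add: v)
  then show "coeff (v \<odot> monom c 0) i = 0"
    by (simp add: coeff_dpoly_mult)
qed (simp_all add: I_mul_left dring.left_diff_distrib)

lemma W_D: "p \<in> W n \<Longrightarrow> D p \<in> W n"
proof (rule W_map[of p D])
  show "D (p - q) = D p - D q" for p q
    by (rule poly_eqI) (simp add: L_minus_R coeff_map_poly delta_diff)
  show "coeff (D v) i = 0" if "\<And>i. i \<ge> n \<Longrightarrow> coeff v i = 0" "i \<ge> n" for v i
    using that by (simp add: L_minus_R coeff_map_poly)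
qed (simp_all add: I_diff I_L I_R)

text \<open>\<open>W 0\<close> is just \<open>I\<close>. Positivity makes the exponent 0 available
  among the \<open>a < n\<close> in \<open>prods_nilpotent\<close>.\<close>

lemma n_pos: "0 < n"
proof (rule ccontr)
  assume "\<not> 0 < n"
  then obtain v where "\<forall>i. coeff v i = 0" "monom b0 0 - v \<in> I"
    using relation by (auto simp: W_def)
  then have "monom b0 0 \<in> I" using poly_eqI[of v 0] by simp
  with b0 show False by (simp add: N_def)
qed

section \<open>The ideals of coefficients whose monomials reduce\<close>

definition Q :: "nat \<Rightarrow> 'a set" where
  "Q s = {b. \<forall>i\<le>n + s. monom b i \<in> W n}"

lemma deriv_ideal_Q: "deriv_ideal \<delta> (Q s)"
  unfolding deriv_ideal_def is_add_subgroup_def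
proof (intro conjI ballI allI)
  show "0 \<in> Q s" by (simp add: Q_def W_I I_0)
  show "a - b \<in> Q s" if "a \<in> Q s" "b \<in> Q s" for a b
    using that by (auto simp: Q_def diff_monom[symmetric] intro: W_diff)
  fix a assume a: "a \<in> Q s"
  show "\<delta> a \<in> Q s"
    using a W_D by (simp add: Q_def monom_delta)
  fix b
  show "b * a \<in> Q s"
    using a W_left_mult by (simp add: Q_def left_mult_monom[symmetric])
  \<comment> \<open>\<open>monom a i \<odot> monom b 0\<close> lies in \<open>W n\<close> and
    differs from the goal by terms \<open>monom (a * c) j\<close> with \<open>j < i\<close>, which
    the induction covers since \<open>b\<close> is arbitrary.\<close>
  have "monom (a * b) i \<in> W n" if "i \<le> n + s" for i b
    using that
  proof (induction i arbitrary: b rule: less_induct)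
    case (less i)
    obtain u where u: "monom a i \<odot> monom b 0 = monom (a * b) i + left_mult a u"
      "\<And>j. j \<ge> i \<Longrightarrow> coeff u j = 0"
      by (rule monom_mul_const[of a i b]) blast
    have "u = (\<Sum>j<i. monom (coeff u j) j)"
      using u(2) by (intro poly_eqI) (auto simp: coeff_sum sum.delta not_less)
    then have "left_mult a u = (\<Sum>j<i. monom (a * coeff u j) j)"
      by (metis (no_types, lifting) left_mult_sum left_mult_monom sum.cong)
    also have "\<dots> \<in> W n" using less by (intro W_sum) simp
    finally have "left_mult a u \<in> W n" .
    moreover have "monom a i \<odot> monom b 0 \<in> W n"
      using a less.prems by (intro W_mul_const) (simp add: Q_def)
    ultimately show ?case using W_diff u(1) by fastforce
  qed
  then show "a * b \<in> Q s" by (simp add: Q_def)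
qed

lemma Q_reduce:
  assumes "p \<in> coeffs_in (Q s)" "\<And>j. j > n + s \<Longrightarrow> coeff p j = 0"
  shows "p \<in> W n"
proof -
  have "degree p \<le> n + s" using assms(2) by (intro degree_le) simp
  then have "p = (\<Sum>i\<le>n + s. monom (coeff p i) i)"
    by (simp add: poly_as_sum_of_monoms')
  also have "\<dots> \<in> W n"
    using assms(1) by (intro W_sum) (auto simp: coeffs_in_def Q_def)
  finally show ?thesis .
qed

text \<open>Multiply the reduction of \<open>monom b n\<close> by \<open>c\<close> on the left and
  by \<open>X\<close> to the power \<open>s + 1\<close> on the right: the result has coefficients in
  \<open>Q s\<close> and degree at most \<open>n + s\<close>, so it reduces once more.\<close>

lemma Q_mult_Q_0:
  assumes c: "c \<in> Q s" and b: "b \<in> Q 0"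
  shows "c * b \<in> Q (Suc s)"
proof -
  have cQ: "c * a \<in> Q s" for a
    using deriv_ideal_Q[of s] c by (simp add: deriv_ideal_def)
  have "monom (c * b) (n + Suc s) \<in> W n"
  proof -
    obtain v where v: "\<And>i. i \<ge> n \<Longrightarrow> coeff v i = 0" "monom b n - v \<in> I"
      using b unfolding Q_def W_def by auto
    let ?f = "\<lambda>p. left_mult c ((R ^^ Suc s) p)"
    have f_diff: "?f (p - q) = ?f p - ?f q" for p q
      by (rule poly_eqI)
         (simp add: coeff_left_mult coeff_R_pow right_diff_distrib del: funpow.simps(2))
    have "?f (monom b n) - ?f v \<in> I"
      unfolding f_diff[symmetric] by (intro I_left_mult I_R_pow v(2))
    then have "?f (monom b n) - ?f v \<in> W n" by (rule W_I)
    moreover have "?f v \<in> W n"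
    proof (rule Q_reduce[of _ s])
      show "?f v \<in> coeffs_in (Q s)"
        using cQ by (simp add: coeffs_in_def coeff_left_mult del: funpow.simps(2))
      show "coeff (?f v) j = 0" if "j > n + s" for j
        using that v(1)[of "j - Suc s"]
        by (simp add: coeff_left_mult coeff_R_pow del: funpow.simps(2))
    qed
    ultimately have "?f (monom b n) \<in> W n" using W_add by fastforce
    then show ?thesis
      by (simp add: R_pow_monom left_mult_monom add.commute del: funpow.simps(2))
  qed
  with cQ[of b] show ?thesis by (auto simp: Q_def le_Suc_eq)
qed

text \<open>Replacing the two factors of \<open>e \<odot> e\<close> by polynomials over
  \<open>Q s\<close> and \<open>Q 0\<close> makes \<open>e\<close> congruent to a polynomial over
  \<open>Q (Suc s)\<close>.\<close>

lemma Q_not_subset_N: "\<not> Q s \<subseteq> N"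
proof (induction s)
  case 0
  have "monom b0 i \<in> W n" if "i \<le> n" for i
    using relation that by (cases "i = n") (auto intro: W_low)
  then have "b0 \<in> Q 0" by (simp add: Q_def)
  with b0 show ?case by blast
next
  case (Suc s)
  have 0: "\<not> Q 0 \<subseteq> N"
  proof
    assume "Q 0 \<subseteq> N"
    then have "Q s \<subseteq> N" by (auto simp: Q_def)
    with Suc show False by blast
  qed
  obtain g h where g: "g \<in> coeffs_in (Q s)" "e - g \<in> I" and h: "h \<in> coeffs_in (Q 0)" "e - h \<in> I"
    using e_cong_coeffs_in[OF deriv_ideal_Q Suc] e_cong_coeffs_in[OF deriv_ideal_Q 0] by metis
  show ?case
  proof
    assume *: "Q (Suc s) \<subseteq> N"
    have "g \<odot> h \<in> coeffs_in N"
      using Q_mult_Q_0 * deriv_ideal_N g h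
      by (intro mul_coeffs_in[OF deriv_ideal_Q[of 0], of N "Q s"]) (auto simp: deriv_ideal_def)
    then have "g \<odot> h \<in> I" by (rule coeffs_in_N)
    then have "e \<odot> e \<in> I" using I_cong[OF I_mul_cong[OF g(2) h(2)]] by blast
    with idempotent e_notin show False using I_cong by blast
  qed
qed

section \<open>Elements represented by matrices of size \<open>n\<close>, and their
  nilpotence\<close>

definition E :: "'a poly set" where
  "E = {v. \<forall>a<n. (L ^^ a) v \<in> W n}"

lemma E_D: "v \<in> E \<Longrightarrow> D v \<in> E"
  by (simp add: E_def L_pow_D W_D)

lemma E_D_pow: "v \<in> E \<Longrightarrow> (D ^^ l) v \<in> E"
  by (induction l) (simp_all add: E_D)

text \<open>The index of \<open>Q\<close> leaves room for the degree of \<open>e\<close>: applying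
  \<open>L\<close> fewer than \<open>n\<close> times keeps the degree below
  \<open>n + degree e\<close>.\<close>

lemma e_mul_const_in_E:
  assumes "k \<in> Q (degree e)"
  shows "e \<odot> monom k 0 \<in> E"
  unfolding E_def
proof (intro CollectI allI impI)
  fix a assume "a < n"
  show "(L ^^ a) (e \<odot> monom k 0) \<in> W n"
  proof (rule Q_reduce[of _ "degree e"])
    have "monom k 0 \<in> coeffs_in (Q (degree e))"
      using assms deriv_ideal_Q[of "degree e"]
      by (auto simp: coeffs_in_def deriv_ideal_def is_add_subgroup_def)
    then show "(L ^^ a) (e \<odot> monom k 0) \<in> coeffs_in (Q (degree e))"
      by (intro L_pow_coeffs_in mul_coeffs_in_right deriv_ideal_Q)
    have "coeff ((L ^^ i) (monom k 0)) j = 0" if "i \<le> degree e" "j \<ge> degree e + 1" for i j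
      using that by (intro coeff_L_pow_above[of 1]) auto
    then have "coeff (e \<odot> monom k 0) j = 0" if "j \<ge> degree e + 1" for j
      using that by (simp add: coeff_dpoly_mult)
    then show "coeff ((L ^^ a) (e \<odot> monom k 0)) j = 0" if "j > n + degree e" for j
      using that \<open>a < n\<close> by (intro coeff_L_pow_above[of "degree e + 1"]) auto
  qed
qed

primrec prods :: "'a poly set \<Rightarrow> nat \<Rightarrow> 'a poly set" where
  "prods F 0 = F"
| "prods F (Suc r) = {w \<odot> z |w z. w \<in> F \<and> z \<in> prods F r}"

text \<open>The coefficients of \<open>V w a\<close> are row \<open>a\<close> of a matrix for
  \<open>w\<close>, and products in \<open>E\<close> correspond to matrix products modulo
  \<open>I\<close>. The finitely many entries generate a nilpotent subring.\<close>

lemma prods_nilpotent: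
  assumes "finite F" "F \<subseteq> E"
  obtains k where "prods F k \<subseteq> I"
proof -
  have "\<forall>w\<in>F. \<forall>a. \<exists>v. a < n \<longrightarrow> (\<forall>i\<ge>n. coeff v i = 0) \<and> (L ^^ a) w - v \<in> I"
    using assms(2) unfolding E_def W_def by blast
  then obtain V where V: "\<And>w a i. w \<in> F \<Longrightarrow> a < n \<Longrightarrow> i \<ge> n \<Longrightarrow> coeff (V w a) i = 0"
    "\<And>w a. w \<in> F \<Longrightarrow> a < n \<Longrightarrow> (L ^^ a) w - V w a \<in> I"
    by metis
  let ?G = "(\<lambda>(w, a, i). coeff (V w a) i) ` (F \<times> {..<n} \<times> {..<n})"
  have G: "coeff (V w a) i \<in> ?G" if "w \<in> F" "a < n" "i < n" for w a i
    using that by (intro image_eqI[of _ _ "(w, a, i)"]) auto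
  have "finite ?G" using assms(1) by simp
  then obtain P k where P: "\<And>r. is_add_subgroup (P r)" "?G \<subseteq> P 0"
    "\<And>r m y. m \<in> ?G \<Longrightarrow> y \<in> P r \<Longrightarrow> m * y \<in> P (Suc r)" "P k = {0}"
    by (rule locally_nilpotent_powers[OF locally_nilpotent, of ?G]) auto
  \<comment> \<open>Classes with a representative of degree below \<open>n\<close> over
    \<open>P r\<close>; each further factor from \<open>F\<close> raises \<open>r\<close>.\<close>
  define U where "U r = {p. \<exists>v\<in>coeffs_in (P r). (\<forall>i\<ge>n. coeff v i = 0) \<and> p - v \<in> I}" for r
  have U_I: "p \<in> U r" if "p \<in> I" for p r
    unfolding U_def using that add_subgroup_zero[OF P(1)]
    by (intro CollectI bexI[of _ 0]) (auto simp: coeffs_in_def)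
  have U_add: "p + q \<in> U r" if pq: "p \<in> U r" "q \<in> U r" for p q r
  proof -
    obtain v w where v: "v \<in> coeffs_in (P r)" "\<forall>i\<ge>n. coeff v i = 0" "p - v \<in> I"
      and w: "w \<in> coeffs_in (P r)" "\<forall>i\<ge>n. coeff w i = 0" "q - w \<in> I"
      using pq unfolding U_def by blast
    have "p + q - (v + w) = (p - v) + (q - w)" by simp
    then have "p + q - (v + w) \<in> I" using I_add[OF v(3) w(3)] by (simp only:)
    moreover have "v + w \<in> coeffs_in (P r)"
      using v(1) w(1) add_subgroup_add[OF P(1)] by (simp add: coeffs_in_def)
    ultimately show ?thesis
      unfolding U_def using v(2) w(2) by (intro CollectI bexI[of _ "v + w"]) auto
  qed
  have U_sum: "sum f A \<in> U r" if "\<And>i. i \<in> A \<Longrightarrow> f i \<in> U r" for f :: "nat \<Rightarrow> 'a poly" and A r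
    using that by (induction A rule: infinite_finite_induct) (auto simp: U_I I_0 U_add)
  have U_mult: "left_mult m p \<in> U (Suc r)" if m: "m \<in> ?G" and p: "p \<in> U r" for m p r
  proof -
    obtain v where v: "v \<in> coeffs_in (P r)" "\<forall>i\<ge>n. coeff v i = 0" "p - v \<in> I"
      using p unfolding U_def by blast
    have "left_mult m p - left_mult m v = left_mult m (p - v)"
      by (rule poly_eqI) (simp add: coeff_left_mult right_diff_distrib)
    then have "left_mult m p - left_mult m v \<in> I" using I_left_mult[OF v(3)] by (simp only:)
    moreover have "left_mult m v \<in> coeffs_in (P (Suc r))"
      using v(1) P(3)[OF m] by (simp add: coeffs_in_def coeff_left_mult)
    ultimately show ?thesis
      unfolding U_def using v(2)
      by (intro CollectI bexI[of _ "left_mult m v"]) (auto simp: coeff_left_mult)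
  qed
  have "\<forall>z\<in>prods F r. \<forall>a<n. (L ^^ a) z \<in> U r" for r
  proof (induction r)
    case 0
    show ?case
    proof (intro ballI allI impI)
      fix z a assume z: "z \<in> prods F 0" "a < n"
      have "coeff (V z a) i \<in> P 0" for i
        using subsetD[OF P(2) G[of z a i]] V(1)[of z a i] z add_subgroup_zero[OF P(1)]
        by (cases "i < n") (simp_all del: image_iff)
      then show "(L ^^ a) z \<in> U 0"
        unfolding U_def using V[of z a] z
        by (intro CollectI bexI[of _ "V z a"]) (auto simp: coeffs_in_def)
    qed
  next
    case (Suc r)
    show ?case
    proof (intro ballI allI impI)
      fix z a assume z: "z \<in> prods F (Suc r)" and a: "a < n"
      then obtain w y where w: "w \<in> F" and y: "y \<in> prods F r" and [simp]: "z = w \<odot> y" by auto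
      \<comment> \<open>Summing up to \<open>n\<close> avoids \<open>n - 1\<close>; the coefficient
        at \<open>n\<close> is zero.\<close>
      have "degree (V w a) \<le> n" using V(1)[OF w a] by (intro degree_le) simp
      then have "V w a \<odot> y = (\<Sum>i\<le>n. left_mult (coeff (V w a) i) ((L ^^ i) y))"
        by (rule dpoly_mult_bound)
      also have "\<dots> \<in> U (Suc r)"
      proof (rule U_sum)
        fix i assume "i \<in> {..n}"
        show "left_mult (coeff (V w a) i) ((L ^^ i) y) \<in> U (Suc r)"
        proof (cases "i < n")
          case True
          with Suc y show ?thesis by (intro U_mult G w a) auto
        next
          case False
          then show ?thesis using V(1)[OF w a, of i] by (simp add: U_I I_0)
        qed
      qed
      finally have "V w a \<odot> y \<in> U (Suc r)" .
      moreover have "(L ^^ a) z - V w a \<odot> y \<in> I"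
        using I_mul_left[OF V(2)[OF w a], of y]
        by (simp add: dring.left_diff_distrib dpoly_mult_X_mult_pow derivation)
      ultimately have "V w a \<odot> y + ((L ^^ a) z - V w a \<odot> y) \<in> U (Suc r)"
        using U_add U_I by blast
      then show "(L ^^ a) z \<in> U (Suc r)" by simp
    qed
  qed
  from this[of k] have "z \<in> U k" if "z \<in> prods F k" for z
    using that n_pos by fastforce
  moreover have "p \<in> I" if "p \<in> U k" for p
  proof -
    obtain v where v: "v \<in> coeffs_in {0}" "p - v \<in> I" using \<open>p \<in> U k\<close> by (auto simp: U_def P(4))
    then have "v = 0" by (intro poly_eqI) (simp add: coeffs_in_def)
    with v show ?thesis by simp
  qed
  ultimately show ?thesis using that by blast
qed

section \<open>Trading powers of \<open>X\<close> for commutators\<close>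

lemma mul_L_pow_in_I:
  assumes "\<And>m. m < l \<Longrightarrow> (D ^^ m) y \<odot> z \<in> I" "m + s < l"
  shows "(D ^^ m) y \<odot> (L ^^ s) z \<in> I"
  using assms(2)
proof (induction s arbitrary: m)
  case (Suc s)
  \<comment> \<open>Moving one \<open>X\<close> to the far left costs one commutator, so
    \<open>m + s\<close> never exceeds its bound.\<close>
  have "(D ^^ m) y \<odot> (L ^^ Suc s) z = L ((D ^^ m) y \<odot> (L ^^ s) z) - (D ^^ Suc m) y \<odot> (L ^^ s) z"
    by (simp add: dring.left_diff_distrib L_mul R_mul)
  also have "\<dots> \<in> I" using Suc.IH[of m] Suc.IH[of "Suc m"] Suc.prems by (intro I_diff I_L) auto
  finally show ?case .
qed (use assms(1) in auto)

definition fixed_by_e :: "'a poly set" where "fixed_by_e = {w. e \<odot> w - w \<in> I}"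

lemma fixed_by_e_diff: "p \<in> fixed_by_e \<Longrightarrow> q \<in> fixed_by_e \<Longrightarrow> p - q \<in> fixed_by_e"
  using I_diff[of "e \<odot> p - p" "e \<odot> q - q"]
  by (simp add: fixed_by_e_def dring.right_diff_distrib algebra_simps)

lemma fixed_by_e_I: "p \<in> I \<Longrightarrow> p \<in> fixed_by_e"
  by (simp add: fixed_by_e_def I_diff I_mul_right)

lemma fixed_by_e_mul: "p \<in> fixed_by_e \<Longrightarrow> p \<odot> q \<in> fixed_by_e"
  using I_mul_left[of "e \<odot> p - p" q]
  by (simp add: fixed_by_e_def dring.left_diff_distrib mul_assoc)

text \<open>\<open>y \<odot> (L ^^ l) z\<close> is fixed because \<open>y\<close> is. Each of
  \<open>l\<close> exchanges of an \<open>L\<close> on \<open>z\<close> for a \<open>D\<close> on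
  \<open>y\<close> changes only the sign modulo \<open>I\<close>.\<close>

lemma D_pow_mul_fixed_by_e:
  assumes "y \<in> fixed_by_e" "\<And>m. m < l \<Longrightarrow> (D ^^ m) y \<odot> z \<in> I"
  shows "(D ^^ l) y \<odot> z \<in> fixed_by_e"
proof -
  have "(D ^^ m) y \<odot> (L ^^ (l - m)) z \<in> fixed_by_e" if "m \<le> l" for m
    using that
  proof (induction m)
    case 0
    show ?case using fixed_by_e_mul[OF assms(1)] by simp
  next
    case (Suc m)
    let ?s = "l - Suc m"
    have s: "l - m = Suc ?s" using Suc.prems by simp
    have "(D ^^ Suc m) y \<odot> (L ^^ ?s) z = L ((D ^^ m) y \<odot> (L ^^ ?s) z) - (D ^^ m) y \<odot> (L ^^ (l - m)) z"
      unfolding s by (simp add: dring.left_diff_distrib L_mul R_mul)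
    also have "\<dots> \<in> fixed_by_e"
      using Suc mul_L_pow_in_I[of l y z m ?s] assms(2)
      by (intro fixed_by_e_diff fixed_by_e_I[OF I_L]) auto
    finally show ?case .
  qed
  from this[of l] show ?thesis by simp
qed

lemma no_relation: False
proof -
  obtain g where g: "g \<in> coeffs_in (Q (degree e))" "e - g \<in> I"
    by (rule e_cong_coeffs_in[OF deriv_ideal_Q Q_not_subset_N])
  let ?d = "degree g"
  define p where "p j = e \<odot> monom (coeff g j) 0" for j
  have pE: "p j \<in> E" for j
    unfolding p_def using g(1) by (intro e_mul_const_in_E) (simp add: coeffs_in_def)
  have p_fixed: "p j \<in> fixed_by_e" for j
    unfolding p_def using idempotent by (intro fixed_by_e_mul) (simp add: fixed_by_e_def)
  \<comment> \<open>\<open>e\<close> is congruent to \<open>e \<odot> e\<close>, hence to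
    \<open>e \<odot> g\<close>; expand \<open>g\<close> in powers of \<open>X\<close>.\<close>
  have e_p: "e - (\<Sum>j\<le>?d. (R ^^ j) (p j)) \<in> I"
  proof -
    have "e \<odot> g = e \<odot> (\<Sum>j\<le>?d. monom (coeff g j) j)" by (simp add: poly_as_sum_of_monoms)
    also have "\<dots> = (\<Sum>j\<le>?d. e \<odot> (R ^^ j) (monom (coeff g j) 0))"
      by (simp add: R_pow_monom mul_sum_right)
    finally have "e \<odot> g = (\<Sum>j\<le>?d. (R ^^ j) (p j))" by (simp add: mul_R_pow p_def)
    moreover have "e \<odot> e - e \<odot> g \<in> I" using I_mul_right[OF g(2), of e]
      by (simp add: dring.right_diff_distrib)
    ultimately show ?thesis using I_trans[OF I_sym[OF idempotent]] by simp
  qed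
  \<comment> \<open>Only powers of \<open>X\<close> up to \<open>?d\<close> occur in
    \<open>e_p\<close>, so commutators up to that order suffice and \<open>F\<close> is
    finite.\<close>
  define F where "F = (\<lambda>(l, j). (D ^^ l) (p j)) ` ({..?d} \<times> {..?d})"
  have F: "(D ^^ l) (p j) \<in> F" if "l \<le> ?d" "j \<le> ?d" for l j
    unfolding F_def using that by (intro image_eqI[of _ _ "(l, j)"]) auto
  have "finite F" "F \<subseteq> E" using pE E_D_pow by (auto simp: F_def)
  then obtain k where k: "prods F k \<subseteq> I" by (rule prods_nilpotent)
  \<comment> \<open>Downward induction: modulo \<open>I\<close>, \<open>z = e z\<close> is a combination of the \<open>p j X\<^sup>j z\<close>, and up to
    terms already known to vanish \<open>p j X\<^sup>l z\<close> equals \<open>D\<^sup>l (p j) z\<close> with sign \<open>(-1)\<^sup>l\<close>, which is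
    fixed by \<open>e\<close> and a longer product.\<close>
  have "\<forall>z\<in>prods F r. z \<in> fixed_by_e \<longrightarrow> z \<in> I" if "r \<le> k" for r
    using that
  proof (induction r rule: inc_induct)
    case (step r)
    show ?case
    proof (intro ballI impI)
      fix z assume z: "z \<in> prods F r" "z \<in> fixed_by_e"
      have in_I: "(D ^^ l) (p j) \<odot> z \<in> I" if "j \<le> ?d" "l \<le> ?d" for j l
        using that(2)
      proof (induction l rule: less_induct)
        case (less l)
        then have "(D ^^ l) (p j) \<odot> z \<in> fixed_by_e"
          by (intro D_pow_mul_fixed_by_e p_fixed) auto
        moreover have "(D ^^ l) (p j) \<odot> z \<in> prods F (Suc r)"
          using F less.prems that(1) z(1) by auto
        ultimately show ?case using step.IH by blast
      qed
      have "(\<Sum>j\<le>?d. (R ^^ j) (p j)) \<odot> z \<in> I"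
        unfolding dpoly_mult_sum_left
      proof (rule I_sum)
        fix j assume "j \<in> {..?d}"
        then have "(D ^^ 0) (p j) \<odot> (L ^^ j) z \<in> I"
          using in_I by (intro mul_L_pow_in_I[of "Suc ?d"]) auto
        then show "(R ^^ j) (p j) \<odot> z \<in> I" by (simp add: R_pow_mul)
      qed
      moreover have "e \<odot> z - (\<Sum>j\<le>?d. (R ^^ j) (p j)) \<odot> z \<in> I"
        using I_mul_left[OF e_p, of z] by (simp add: dring.left_diff_distrib)
      ultimately have "e \<odot> z \<in> I" using I_cong by blast
      with z(2) show "z \<in> I" unfolding fixed_by_e_def using I_cong by blast
    qed
  qed (use k in blast)
  from this[of 0] have "p j \<in> I" if "j \<le> ?d" for j
    using F[of 0 j] that p_fixed by auto
  then have "(\<Sum>j\<le>?d. (R ^^ j) (p j)) \<in> I" by (intro I_sum I_R_pow) simp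
  with e_p e_notin show False using I_cong by blast
qed

end

context idempotent_mod_ideal
begin

lemma no_idempotent_mod_ideal: False
proof -
  obtain b n where "b \<notin> N" "monom b n \<in> W n" by (rule ex_relation)
  then interpret idempotent_mod_ideal_relation \<delta> I e b n by unfold_locales
  show False by (rule no_relation)
qed

end

section \<open>Choice of the ideal\<close>

lemma X_ideal_Union_chain:
  assumes "C \<noteq> {}" "\<And>I. I \<in> C \<Longrightarrow> X_ideal \<delta> I" "\<And>I J. I \<in> C \<Longrightarrow> J \<in> C \<Longrightarrow> I \<subseteq> J \<or> J \<subseteq> I"
  shows "X_ideal \<delta> (\<Union>C)"
  unfolding X_ideal_def
proof (intro conjI ballI)
  show "0 \<in> \<Union>C" using assms(1,2) by (auto simp: X_ideal_def)
next
  fix p q assume "p \<in> \<Union>C" "q \<in> \<Union>C"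
  then obtain I J where IJ: "I \<in> C" "J \<in> C" "p \<in> I" "q \<in> J" by blast
  from assms(3)[OF IJ(1,2)] obtain K where "K \<in> C" "p \<in> K" "q \<in> K"
    using IJ by blast
  with assms(2)[of K] have "p - q \<in> K" by (simp add: X_ideal_def)
  with \<open>K \<in> C\<close> show "p - q \<in> \<Union>C" by blast
next
  fix p assume "p \<in> \<Union>C"
  then obtain I where I: "I \<in> C" "p \<in> I" by blast
  with assms(2)[of I] have "X_mult \<delta> p \<in> I" "pCons 0 p \<in> I"
    "\<forall>q. dpoly_mult \<delta> p q \<in> I \<and> dpoly_mult \<delta> q p \<in> I"
    by (simp_all add: X_ideal_def)
  with I(1) show "X_mult \<delta> p \<in> \<Union>C" "pCons 0 p \<in> \<Union>C"
    "\<forall>q. dpoly_mult \<delta> p q \<in> \<Union>C \<and> dpoly_mult \<delta> q p \<in> \<Union>C"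
    by blast+
qed

lemma ex_maximal_X_ideal:
  assumes "X_ideal \<delta> K" "f \<notin> K"
  obtains I where "X_ideal \<delta> I" "K \<subseteq> I" "f \<notin> I"
    "\<And>I'. X_ideal \<delta> I' \<Longrightarrow> I \<subset> I' \<Longrightarrow> f \<in> I'"
proof -
  let ?A = "{I. X_ideal \<delta> I \<and> K \<subseteq> I \<and> f \<notin> I}"
  have "\<exists>M\<in>?A. \<forall>X\<in>?A. M \<subseteq> X \<longrightarrow> X = M"
  proof (rule subset_Zorn_nonempty)
    show "?A \<noteq> {}" using assms by blast
    fix C assume C: "C \<noteq> {}" "subset.chain ?A C"
    then have "X_ideal \<delta> (\<Union>C)"
      by (intro X_ideal_Union_chain) (auto simp: subset_chain_def)
    moreover obtain J where "J \<in> C" using C(1) by blast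
    then have "K \<subseteq> \<Union>C" "f \<notin> \<Union>C"
      using C(2) by (auto simp: subset_chain_def)
    ultimately show "\<Union>C \<in> ?A" by blast
  qed
  then obtain M where M: "X_ideal \<delta> M" "K \<subseteq> M" "f \<notin> M"
    and max: "\<forall>X\<in>?A. M \<subseteq> X \<longrightarrow> X = M" by blast
  show ?thesis
  proof (rule that[OF M])
    fix I' assume "X_ideal \<delta> I'" "M \<subset> I'"
    with max M(2) show "f \<in> I'" by blast
  qed
qed

theorem theorem1:
  fixes \<delta> :: "'a::ring \<Rightarrow> 'a" and \<phi> :: "'a poly \<Rightarrow> 'b::ring"
  assumes "locally_nilpotent TYPE('a)"
    and "derivation \<delta>"
    and "dpoly_ring_hom \<delta> \<phi>"
    and "surj \<phi>"
  shows "\<forall>e::'b. e * e = e \<longrightarrow> e = 0"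
proof (intro allI impI, rule ccontr)
  interpret ring_derivation \<delta> by unfold_locales fact
  fix e :: 'b assume e: "e * e = e" "e \<noteq> 0"
  from assms(4) obtain f where f: "\<phi> f = e" by (metis surjD)
  have \<phi>_add: "\<phi> (p + q) = \<phi> p + \<phi> q" and \<phi>_mult: "\<phi> (p \<odot> q) = \<phi> p * \<phi> q" for p q
    using assms(3) by (auto simp: dpoly_ring_hom_def)
  have \<phi>_diff: "\<phi> (p - q) = \<phi> p - \<phi> q" for p q
    using \<phi>_add[of "p - q" q] by (simp add: eq_diff_eq)
  have \<phi>_0: "\<phi> 0 = 0" using \<phi>_diff[of 0 0] by simp
  \<comment> \<open>The kernel of \<open>\<phi>\<close> itself need not be closed under multiplication by \<open>X\<close>.\<close>
  define K where "K = {g. \<forall>s t. \<phi> (s \<odot> g \<odot> t) = 0}"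
  have "X_ideal \<delta> K"
    unfolding X_ideal_def
  proof (intro conjI ballI allI)
    show "0 \<in> K" by (simp add: K_def \<phi>_0)
    fix p assume p: "p \<in> K"
    show "p - q \<in> K" if "q \<in> K" for q
      using p that by (simp add: K_def dring.left_diff_distrib dring.right_diff_distrib \<phi>_diff)
    \<comment> \<open>The outer factors \<open>s\<close> and \<open>t\<close> absorb
      \<open>X\<close>.\<close>
    have "s \<odot> L p \<odot> t = R s \<odot> p \<odot> t" for s t by (simp add: R_mul)
    then show "L p \<in> K" using p by (simp add: K_def)
    have "s \<odot> R p \<odot> t = s \<odot> p \<odot> L t" for s t by (simp add: mul_R R_mul)
    then show "R p \<in> K" using p by (simp add: K_def)
    fix q
    have "s \<odot> (p \<odot> q) \<odot> t = s \<odot> p \<odot> (q \<odot> t)" "s \<odot> (q \<odot> p) \<odot> t = (s \<odot> q) \<odot> p \<odot> t" for s t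
      by (simp_all add: mul_assoc)
    then show "p \<odot> q \<in> K" "q \<odot> p \<in> K" using p by (simp_all add: K_def)
  qed
  moreover have "f \<notin> K"
  proof
    assume "f \<in> K"
    \<comment> \<open>Take \<open>s = t = f\<close>; the image is the cube of \<open>e\<close>,
      which is \<open>e\<close>.\<close>
    then have "\<phi> (f \<odot> f \<odot> f) = 0" by (simp add: K_def)
    with e show False by (simp add: \<phi>_mult f)
  qed
  ultimately obtain I where I: "X_ideal \<delta> I" "K \<subseteq> I" "f \<notin> I"
    "\<And>I'. X_ideal \<delta> I' \<Longrightarrow> I \<subset> I' \<Longrightarrow> f \<in> I'"
    by (rule ex_maximal_X_ideal) auto
  have "f \<odot> f - f \<in> K" by (simp add: K_def \<phi>_mult \<phi>_diff f e(1))
  with I(2) have "f \<odot> f - f \<in> I" by blast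
  then interpret idempotent_mod_ideal \<delta> I f
    using assms(1) I by unfold_locales
  show False by (rule no_idempotent_mod_ideal)
qed

end
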